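(* Let $(X,d)$ be a metric space, let $m\in X$, and let $\phi:X\times X\to\mathbb{R}$ be a nonnegative symmetric function. Then the identity map from $(X,d^{\phi,m})$ to $(X,d)$ is a homeomorphism.
   Context: For $x,y\in X$ put $$\delta^{\phi,m}(x,y)=\min\left\{ d(x,y),\ \frac{1}{1+d(m,x)}+\phi(x,y)+\frac{1}{1+d(m,y)}\right\}.$$ For $n\in\mathbb{N}=\{1,2,\dots\}$ let $\Gamma^n_{x,y}$ be the set of all tuples $(x_0,\dots,x_n)$ of points of $X$ with $x_0=x$ and $x_n=y$, and let $\Gamma_{x,y}=\bigcup_{n\in\mathbb{N}}\Gamma^n_{x,y}$. Define $$d^{\phi,m}(x,y)=\inf\left\{\sum_{i=1}^n\delta^{\phi,m}(x_{i-1},x_i)\ :\ (x_0,\dots,x_n)\in\Gamma_{x,y},\ n\in\mathbb{N}\right\}.$$ "Symmetric" means $\phi(x,y)=\phi(y,x)$ for all $x,y\in X$. The function $d^{\phi,m}$ is a metric on $X$. *)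

theory Defs
  imports "HOL-Analysis.Analysis"
begin

definition delta :: "('a \<Rightarrow> 'a \<Rightarrow> real) \<Rightarrow> ('a \<Rightarrow> 'a \<Rightarrow> real) \<Rightarrow> 'a \<Rightarrow> 'a \<Rightarrow> 'a \<Rightarrow> real" where
  "delta d \<phi> m x y = min (d x y) (1 / (1 + d m x) + \<phi> x y + 1 / (1 + d m y))"

(* A tuple (x_0, ..., x_n) of points of X is an extensional function on {0..n}. *)
definition chain_tuples :: "'a set \<Rightarrow> nat \<Rightarrow> 'a \<Rightarrow> 'a \<Rightarrow> (nat \<Rightarrow> 'a) set" where
  "chain_tuples X n x y = {s \<in> {0..n} \<rightarrow>\<^sub>E X. s 0 = x \<and> s n = y}"

definition chain_sums ::
  "'a set \<Rightarrow> ('a \<Rightarrow> 'a \<Rightarrow> real) \<Rightarrow> ('a \<Rightarrow> 'a \<Rightarrow> real) \<Rightarrow> 'a \<Rightarrow> 'a \<Rightarrow> 'a \<Rightarrow> real set" where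
  "chain_sums X d \<phi> m x y =
     {\<Sum>i=1..n. delta d \<phi> m (s (i - 1)) (s i) | n s. 1 \<le> n \<and> s \<in> chain_tuples X n x y}"

(* The value 0 for points outside X is a convention: Metric_space requires nonnegativity and
   symmetry on the whole type. The topology does not depend on it. *)
definition chain_dist ::
  "'a set \<Rightarrow> ('a \<Rightarrow> 'a \<Rightarrow> real) \<Rightarrow> ('a \<Rightarrow> 'a \<Rightarrow> real) \<Rightarrow> 'a \<Rightarrow> 'a \<Rightarrow> 'a \<Rightarrow> real" where
  "chain_dist X d \<phi> m x y = (if x \<in> X \<and> y \<in> X then Inf (chain_sums X d \<phi> m x y) else 0)"

context
  fixes X :: "'a set" and d :: "'a \<Rightarrow> 'a \<Rightarrow> real" and m :: 'a and \<phi> :: "'a \<Rightarrow> 'a \<Rightarrow> real"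
  assumes met: "Metric_space X d" and mX: "m \<in> X"
    and phi_nonneg: "\<And>x y. x \<in> X \<Longrightarrow> y \<in> X \<Longrightarrow> 0 \<le> \<phi> x y"
    and phi_sym: "\<And>x y. x \<in> X \<Longrightarrow> y \<in> X \<Longrightarrow> \<phi> x y = \<phi> y x"
begin

interpretation Metric_space X d by (rule met)

lemma delta_nonneg: "x \<in> X \<Longrightarrow> y \<in> X \<Longrightarrow> 0 \<le> delta d \<phi> m x y"
  using phi_nonneg[of x y] by (simp add: delta_def add_nonneg_nonneg)

lemma delta_commute: "x \<in> X \<Longrightarrow> y \<in> X \<Longrightarrow> delta d \<phi> m x y = delta d \<phi> m y x"
  using phi_sym[of x y] by (simp add: delta_def commute[of x y] add.commute add.left_commute)

lemma chain_sumsI: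
  fixes n :: nat and s :: "nat \<Rightarrow> 'a"
  assumes "1 \<le> n" "\<And>i. i \<le> n \<Longrightarrow> s i \<in> X" "s 0 = x" "s n = y"
  shows "(\<Sum>i=1..n. delta d \<phi> m (s (i - 1)) (s i)) \<in> chain_sums X d \<phi> m x y"
proof -
  have "restrict s {0..n} \<in> chain_tuples X n x y"
    using assms by (auto simp: chain_tuples_def)
  moreover have "(\<Sum>i=1..n. delta d \<phi> m (s (i - 1)) (s i)) =
      (\<Sum>i=1..n. delta d \<phi> m (restrict s {0..n} (i - 1)) (restrict s {0..n} i))"
    by (rule sum.cong) auto
  ultimately show ?thesis using assms(1) unfolding chain_sums_def by blast
qed

lemma chain_sumsD:
  assumes "a \<in> chain_sums X d \<phi> m x y"
  shows "\<exists>(n::nat) s. 1 \<le> n \<and> (\<forall>i\<le>n. s i \<in> X) \<and> s 0 = x \<and> s n = y \<and>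
    a = (\<Sum>i=1..n. delta d \<phi> m (s (i - 1)) (s i))"
proof -
  obtain n :: nat and s where "1 \<le> n" "s \<in> chain_tuples X n x y"
    "a = (\<Sum>i=1..n. delta d \<phi> m (s (i - 1)) (s i))"
    using assms unfolding chain_sums_def by blast
  then show ?thesis by (intro exI[of _ n] exI[of _ s]) (auto simp: chain_tuples_def PiE_iff)
qed

lemma chain_sums_delta:
  assumes "x \<in> X" "y \<in> X" shows "delta d \<phi> m x y \<in> chain_sums X d \<phi> m x y"
  using chain_sumsI[of 1 "\<lambda>i. if i = 0 then x else y" x y] assms by auto

lemma chain_sums_nonneg:
  assumes "a \<in> chain_sums X d \<phi> m x y" shows "0 \<le> a"
  using chain_sumsD[OF assms]
  by (auto intro!: sum_nonneg delta_nonneg simp: le_diff_conv)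

lemma chain_sums_bdd: "bdd_below (chain_sums X d \<phi> m x y)"
  using chain_sums_nonneg by (meson bdd_belowI)

lemma chain_sums_commute_subset: "chain_sums X d \<phi> m x y \<subseteq> chain_sums X d \<phi> m y x"
proof
  fix a assume "a \<in> chain_sums X d \<phi> m x y"
  from chain_sumsD[OF this] obtain n :: nat and s where s: "1 \<le> n" "\<And>i. i \<le> n \<Longrightarrow> s i \<in> X" "s 0 = x" "s n = y"
    and a: "a = (\<Sum>i=1..n. delta d \<phi> m (s (i - 1)) (s i))" by blast
  have "(\<Sum>i=1..n. delta d \<phi> m (s (n - (i - 1))) (s (n - i))) =
        (\<Sum>i=1..n. delta d \<phi> m (s (i - 1)) (s i))"
  proof (rule sum.reindex_bij_witness[where i = "\<lambda>i. n + 1 - i" and j = "\<lambda>i. n + 1 - i"])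
    fix i assume i: "i \<in> {1..n}"
    have "n + 1 - i - 1 = n - i" "n + 1 - i = n - (i - 1)" using i by auto
    then show "delta d \<phi> m (s (n + 1 - i - 1)) (s (n + 1 - i)) =
        delta d \<phi> m (s (n - (i - 1))) (s (n - i))"
      using s(2) by (metis delta_commute diff_le_self)
  qed auto
  then show "a \<in> chain_sums X d \<phi> m y x"
    using chain_sumsI[of n "\<lambda>i. s (n - i)" y x] s a by simp
qed

lemma chain_sums_add:
  assumes "a \<in> chain_sums X d \<phi> m x y" "b \<in> chain_sums X d \<phi> m y z"
  shows "a + b \<in> chain_sums X d \<phi> m x z"
proof -
  obtain n :: nat and s where s: "1 \<le> n" "\<And>i. i \<le> n \<Longrightarrow> s i \<in> X" "s 0 = x" "s n = y"
    and a: "a = (\<Sum>i=1..n. delta d \<phi> m (s (i - 1)) (s i))"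
    using chain_sumsD[OF assms(1)] by blast
  obtain k :: nat and t where t: "1 \<le> k" "\<And>i. i \<le> k \<Longrightarrow> t i \<in> X" "t 0 = y" "t k = z"
    and b: "b = (\<Sum>i=1..k. delta d \<phi> m (t (i - 1)) (t i))"
    using chain_sumsD[OF assms(2)] by blast
  define u where "u i = (if i \<le> n then s i else t (i - n))" for i
  have "(\<Sum>i=1..n+k. delta d \<phi> m (u (i - 1)) (u i)) =
      (\<Sum>i=1..n. delta d \<phi> m (u (i - 1)) (u i)) + (\<Sum>i=n+1..n+k. delta d \<phi> m (u (i - 1)) (u i))"
    by (rule sum.ub_add_nat) simp
  also have "(\<Sum>i=1..n. delta d \<phi> m (u (i - 1)) (u i)) = a"
    unfolding a by (rule sum.cong) (auto simp: u_def)
  also have "(\<Sum>i=n+1..n+k. delta d \<phi> m (u (i - 1)) (u i)) = b"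
    unfolding b
  proof (rule sum.reindex_bij_witness[where i = "\<lambda>i. i + n" and j = "\<lambda>i. i - n"])
    fix i assume i: "i \<in> {n+1..n+k}"
    have "u (i - 1) = t (i - n - 1)"
    proof (cases "i = n + 1")
      case True then show ?thesis using s(4) t(3) by (simp add: u_def)
    next
      case False
      then have "\<not> i - 1 \<le> n" "i - 1 - n = i - n - 1" using i by auto
      then show ?thesis by (simp add: u_def)
    qed
    moreover have "u i = t (i - n)" using i by (auto simp: u_def)
    ultimately show "delta d \<phi> m (t (i - n - 1)) (t (i - n)) = delta d \<phi> m (u (i - 1)) (u i)"
      by simp
  qed auto
  finally have "a + b = (\<Sum>i=1..n+k. delta d \<phi> m (u (i - 1)) (u i))" by simp
  also have "\<dots> \<in> chain_sums X d \<phi> m x z"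
    by (rule chain_sumsI) (use s t in \<open>auto simp: u_def\<close>)
  finally show ?thesis .
qed

lemma jump_lower_bound:
  assumes "x \<in> X" "z \<in> X" shows "1 / (1 + d m x) \<le> d x z + 1 / (1 + d m z)"
proof -
  have "1 / (1 + d m x) - 1 / (1 + d m z) = (d m z - d m x) / ((1 + d m x) * (1 + d m z))"
    by (subst diff_frac_eq) (use nonneg[of m x] nonneg[of m z] in \<open>auto simp del: nonneg\<close>)
  also have "\<dots> \<le> d x z / ((1 + d m x) * (1 + d m z))"
    using triangle[of m x z] assms mX by (intro divide_right_mono) auto
  also have "\<dots> \<le> d x z / 1"
  proof (rule divide_left_mono)
    show "1 \<le> (1 + d m x) * (1 + d m z)" by (simp add: algebra_simps)
  qed (auto simp: algebra_simps add_pos_nonneg)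
  finally show ?thesis by simp
qed

lemma sum_lower_bound:
  fixes n :: nat and s :: "nat \<Rightarrow> 'a"
  assumes "\<And>i. i \<le> n \<Longrightarrow> s i \<in> X"
  shows "min (d (s 0) (s n)) (1 / (1 + d m (s 0))) \<le>
    (\<Sum>i=1..n. delta d \<phi> m (s (i - 1)) (s i))"
  using assms
proof (induction n)
  case 0
  then show ?case by simp
next
  case (Suc n)
  have X: "s 0 \<in> X" "s n \<in> X" "s (Suc n) \<in> X" using Suc.prems by auto
  have "min (d (s 0) (s n)) (1 / (1 + d m (s 0))) \<le>
    (\<Sum>i=1..n. delta d \<phi> m (s (i - 1)) (s i))" using Suc by simp
  moreover have "0 \<le> delta d \<phi> m (s n) (s (Suc n))" using X by (intro delta_nonneg)
  moreover have "delta d \<phi> m (s n) (s (Suc n)) = d (s n) (s (Suc n)) \<or>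
      1 / (1 + d m (s n)) \<le> delta d \<phi> m (s n) (s (Suc n))"
    using phi_nonneg[of "s n" "s (Suc n)"] X unfolding delta_def min_def by auto
  moreover have "d (s 0) (s (Suc n)) \<le> d (s 0) (s n) + d (s n) (s (Suc n))"
    using X by (intro triangle)
  moreover have "1 / (1 + d m (s 0)) \<le> d (s 0) (s n) + 1 / (1 + d m (s n))"
    using X by (intro jump_lower_bound)
  ultimately have "min (d (s 0) (s (Suc n))) (1 / (1 + d m (s 0))) \<le>
     (\<Sum>i=1..n. delta d \<phi> m (s (i - 1)) (s i)) + delta d \<phi> m (s n) (s (Suc n))"
    by linarith
  then show ?case by simp
qed

lemma chain_dist_lower_bound:
  assumes "x \<in> X" "y \<in> X"
  shows "min (d x y) (1 / (1 + d m x)) \<le> chain_dist X d \<phi> m x y"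
proof -
  have "min (d x y) (1 / (1 + d m x)) \<le> Inf (chain_sums X d \<phi> m x y)"
  proof (rule cInf_greatest)
    show "chain_sums X d \<phi> m x y \<noteq> {}" using chain_sums_delta[OF assms] by auto
    fix a assume "a \<in> chain_sums X d \<phi> m x y"
    from chain_sumsD[OF this] obtain n :: nat and s where s: "1 \<le> n" "\<And>i. i \<le> n \<Longrightarrow> s i \<in> X" "s 0 = x" "s n = y"
      "a = (\<Sum>i=1..n. delta d \<phi> m (s (i - 1)) (s i))" by blast
    then show "min (d x y) (1 / (1 + d m x)) \<le> a"
      using sum_lower_bound[of n s] by simp
  qed
  then show ?thesis using assms by (simp add: chain_dist_def)
qed

lemma chain_dist_le:
  assumes "a \<in> chain_sums X d \<phi> m x y" "x \<in> X" "y \<in> X"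
  shows "chain_dist X d \<phi> m x y \<le> a"
  using assms chain_sums_bdd by (simp add: chain_dist_def cInf_lower)

theorem Metric_space_chain_dist: "Metric_space X (chain_dist X d \<phi> m)"
proof
  fix x y
  have "0 \<le> Inf (chain_sums X d \<phi> m x y)" if "x \<in> X" "y \<in> X"
    by (rule cInf_greatest) (use chain_sums_delta[OF that] chain_sums_nonneg in auto)
  then show "0 \<le> chain_dist X d \<phi> m x y"
    by (simp add: chain_dist_def)
  have "chain_sums X d \<phi> m x y = chain_sums X d \<phi> m y x"
    using chain_sums_commute_subset by blast
  then show "chain_dist X d \<phi> m x y = chain_dist X d \<phi> m y x"
    by (auto simp: chain_dist_def)
next
  fix x y assume xy: "x \<in> X" "y \<in> X"
  have pos: "0 < 1 / (1 + d m x)" by (simp add: add_pos_nonneg)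
  have "chain_dist X d \<phi> m x x \<le> 0" if "x \<in> X"
    using chain_dist_le[OF chain_sums_delta, of x x] that phi_nonneg[of x x]
    by (auto simp: delta_def)
  moreover have "0 \<le> chain_dist X d \<phi> m x x"
    using chain_dist_lower_bound[of x x] xy pos by simp
  moreover have "d x y \<le> 0" if "chain_dist X d \<phi> m x y = 0"
    using chain_dist_lower_bound[OF xy] pos that by (auto simp: min_def split: if_splits)
  ultimately show "(chain_dist X d \<phi> m x y = 0) = (x = y)"
    using xy by (metis nonneg order_antisym zero)
next
  fix x y z assume xyz: "x \<in> X" "y \<in> X" "z \<in> X"
  let ?D = "chain_dist X d \<phi> m"
  have "?D x z - b \<le> ?D x y" if "b \<in> chain_sums X d \<phi> m y z" for b
  proof -
    have "?D x z - b \<le> Inf (chain_sums X d \<phi> m x y)"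
    proof (rule cInf_greatest)
      show "chain_sums X d \<phi> m x y \<noteq> {}" using chain_sums_delta xyz by blast
      show "?D x z - b \<le> a" if "a \<in> chain_sums X d \<phi> m x y" for a
        using chain_dist_le[OF chain_sums_add[OF that \<open>b \<in> _\<close>]] xyz by simp
    qed
    then show ?thesis using xyz by (simp add: chain_dist_def)
  qed
  then have *: "?D x z - ?D x y \<le> b" if "b \<in> chain_sums X d \<phi> m y z" for b
    using that by fastforce
  have "?D x z - ?D x y \<le> Inf (chain_sums X d \<phi> m y z)"
    by (rule cInf_greatest) (use chain_sums_delta xyz * in auto)
  then show "?D x z \<le> ?D x y + ?D y z" using xyz by (simp add: chain_dist_def)
qed

end

end

theory Submission
  imports Defs
begin

text \<open>
  The two metrics generate the same topology because they are comparable near every point.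
  The chain metric is at most \<open>d\<close>, as the one-step chain from \<open>x\<close> to \<open>y\<close> costs at most
  \<open>d x y\<close>. Conversely, \<open>chain_dist_lower_bound\<close> says that no chain starting at \<open>x\<close> is cheaper
  than \<open>min (d x y) r\<close> with \<open>r = 1 / (1 + d m x)\<close>: a shortcut taken at \<open>z\<close> costs at least
  \<open>1 / (1 + d m z)\<close>, and since \<open>z \<mapsto> 1 / (1 + d m z)\<close> is 1-Lipschitz for \<open>d\<close>, walking from \<open>x\<close> to \<open>z\<close>
  in order to lower this fee costs at least as much as it saves. As \<open>r\<close> depends only on \<open>x\<close> and is positive,
  sufficiently small balls around \<open>x\<close> for the two metrics are nested in each other
  (\<open>mtopology_eq_if_locally_comparable\<close>).
\<close>

text \<open>
  The bound \<open>D \<le> d\<close> puts each \<open>d\<close>-ball inside the \<open>D\<close>-ball of the same radius. The truncated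
  bound puts the \<open>D\<close>-ball of radius \<open>min e r\<close> inside the \<open>d\<close>-ball of radius \<open>e\<close>; the truncation
  radius \<open>r\<close> may vary with the centre, since openness is tested one point at a time.
\<close>

lemma mtopology_eq_if_locally_comparable:
  assumes "Metric_space X d" and "Metric_space X D"
    and le: "\<And>x y. x \<in> X \<Longrightarrow> y \<in> X \<Longrightarrow> D x y \<le> d x y"
    and ge: "\<And>x. x \<in> X \<Longrightarrow> \<exists>r>0. \<forall>y\<in>X. min (d x y) r \<le> D x y"
  shows "Metric_space.mtopology X D = Metric_space.mtopology X d"
proof -
  interpret d: Metric_space X d by fact
  interpret D: Metric_space X D by fact
  have d_in_D: "d.mball x e \<subseteq> D.mball x e" for x e
  proof
    fix y assume "y \<in> d.mball x e"
    then show "y \<in> D.mball x e" using le[of x y] by (simp add: d.in_mball D.in_mball)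
  qed
  have D_in_d: "\<exists>e'>0. D.mball x e' \<subseteq> d.mball x e" if x: "x \<in> X" and e: "e > 0" for x e
  proof -
    obtain r where "r > 0" and r: "\<And>y. y \<in> X \<Longrightarrow> min (d x y) r \<le> D x y"
      using ge[OF x] by blast
    have "D.mball x (min e r) \<subseteq> d.mball x e"
    proof
      fix y assume "y \<in> D.mball x (min e r)"
      then have "y \<in> X" "D x y < min e r" by simp_all
      then have "d x y < e" using r[of y] by linarith
      then show "y \<in> d.mball x e" using x \<open>y \<in> X\<close> by simp
    qed
    moreover have "min e r > 0" using \<open>r > 0\<close> e by simp
    ultimately show ?thesis by blast
  qed
  have "openin D.mtopology U = openin d.mtopology U" for U
  proof
    assume "openin D.mtopology U"
    then show "openin d.mtopology U"
      unfolding D.openin_mtopology d.openin_mtopology using d_in_D by (meson order_trans)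
  next
    assume U: "openin d.mtopology U"
    have "\<exists>e>0. D.mball x e \<subseteq> U" if x: "x \<in> U" for x
    proof -
      obtain e where "x \<in> X" "e > 0" "d.mball x e \<subseteq> U"
        using U x unfolding d.openin_mtopology by blast
      then show ?thesis using D_in_d by (meson order_trans)
    qed
    then show "openin D.mtopology U"
      using U unfolding D.openin_mtopology d.openin_mtopology by blast
  qed
  then show ?thesis by (simp add: topology_eq)
qed

theorem corollary1p1:
  fixes X :: "'a set" and d :: "'a \<Rightarrow> 'a \<Rightarrow> real" and m :: 'a and \<phi> :: "'a \<Rightarrow> 'a \<Rightarrow> real"
  assumes "Metric_space X d"
    and "m \<in> X"
    and "\<And>x y. x \<in> X \<Longrightarrow> y \<in> X \<Longrightarrow> 0 \<le> \<phi> x y"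
    and "\<And>x y. x \<in> X \<Longrightarrow> y \<in> X \<Longrightarrow> \<phi> x y = \<phi> y x"
  shows "homeomorphic_map
           (Metric_space.mtopology X (chain_dist X d \<phi> m))
           (Metric_space.mtopology X d)
           id"
proof -
  interpret d: Metric_space X d by fact
  have "Metric_space.mtopology X (chain_dist X d \<phi> m) = d.mtopology"
  proof (rule mtopology_eq_if_locally_comparable)
    show "Metric_space X d" by fact
    show "Metric_space X (chain_dist X d \<phi> m)"
      using assms by (rule Metric_space_chain_dist)
  next
    fix x y assume xy: "x \<in> X" "y \<in> X"
    have "chain_dist X d \<phi> m x y \<le> delta d \<phi> m x y"
      using chain_dist_le[OF assms chain_sums_delta[OF assms xy] xy] by simp
    also have "\<dots> \<le> d x y" by (simp add: delta_def)
    finally show "chain_dist X d \<phi> m x y \<le> d x y" .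
  next
    fix x assume x: "x \<in> X"
    have "0 < 1 / (1 + d m x)" by (simp add: add_pos_nonneg)
    moreover have "min (d x y) (1 / (1 + d m x)) \<le> chain_dist X d \<phi> m x y" if "y \<in> X" for y
      using chain_dist_lower_bound[OF assms x that] by simp
    ultimately show "\<exists>r>0. \<forall>y\<in>X. min (d x y) r \<le> chain_dist X d \<phi> m x y" by blast
  qed
  then show ?thesis by simp
qed

end
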